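(* Let $X\neq\{0\}$ be a Banach space. For every $p,q\in\mathcal{N}(X)$, $$\Phi(q)\preceq_{H(X)}\Phi(p)\quad\Longleftrightarrow\quad q\preceq_{\mathcal{N}(X)}p.$$ Moreover, if $p$ and $q$ belong to the same intrinsic part of $\mathcal{N}(X)$, then $$d_{H(X)}([\Phi(p)],[\Phi(q)])=d_{\mathcal{N}(X)}([p],[q]).$$
   Context: $\mathcal{N}(X)$ is the set of all norms on $X$ equivalent to the given norm of the Banach space $X$. For $p\in\mathcal{N}(X)$, $\Delta_p:X\times X\to\mathbb{R}$, $\Delta_p(x,y)=p(x)+p(y)-p(x+y)$, and $\Phi(p)=(p,\Delta_p)$. For a set $A$, $\mathbb{R}^A_+$ is the cone of functions $f:A\to\mathbb{R}$ with $f\ge0$ pointwise. Let $\mathcal{N}(X)-\mathcal{N}(X)=\{p-q\mid p,q\in\mathcal{N}(X)\}$ and $$U(X)=\{f\in\mathcal{N}(X)-\mathcal{N}(X)\mid\exists r\in\mathcal{N}(X)\text{ with }f(x)\ge r(x)\ \forall x\in X\}\cup\{0\},\qquad H(X)=U(X)\times\mathbb{R}^{X\times X}_+,$$ which is a cone (closed under sums and positive multiples, contains $0$, with $H(X)\cap(-H(X))=\{0\}$) in the product of the function spaces $\mathbb{R}^X\times\mathbb{R}^{X\times X}$. The induced order is the product order: $(f_1,g_1)\preceq_{H(X)}(f_2,g_2)$ iff $f_2-f_1\in U(X)$ and $g_2-g_1\in\mathbb{R}^{X\times X}_+$. The intrinsic order is $q\preceq_{\mathcal{N}(X)}p$ iff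 $p-q\in\mathcal{N}(X)\cup\{0\}$. Norms $p,q$ belong to the same intrinsic part if $\alpha p\preceq_{\mathcal{N}(X)}q\preceq_{\mathcal{N}(X)}\beta p$ for some $\alpha,\beta>0$. For a cone $C$ with order $\preceq_C$ and nonzero comparable $u,v\in C$ (i.e. $\alpha u\preceq_C v\preceq_C\beta u$ for some $\alpha,\beta>0$), the Hilbert projective metric is $d_C([u],[v])=\log\frac{M_C(v/u)}{m_C(v/u)}$, with $M_C(v/u)=\inf\{\lambda>0\mid v\preceq_C\lambda u\}$, $m_C(v/u)=\sup\{\lambda>0\mid\lambda u\preceq_C v\}$ (and $d_C=\infty$ for nonzero non-comparable elements); $[u]$ is the class of $u$ modulo positive scalars. $d_{H(X)}$ is this metric for $C=H(X)$, and $d_{\mathcal{N}(X)}$ is this metric for $C=\mathcal{N}(X)\cup\{0\}$, with order $\preceq_{\mathcal{N}(X)}$. *)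

theory Defs
  imports "HOL-Analysis.Analysis" "HOL-Library.Function_Algebras"
begin

text \<open>Function spaces \<open>\<real>\<^sup>A\<close> as real vector spaces with pointwise operations
  (addition is provided by \<^theory>\<open>HOL-Library.Function_Algebras\<close>).\<close>

instantiation "fun" :: (type, real_vector) real_vector
begin

definition scaleR_fun :: "real \<Rightarrow> ('a \<Rightarrow> 'b) \<Rightarrow> 'a \<Rightarrow> 'b"
  where "scaleR_fun c f = (\<lambda>x. c *\<^sub>R f x)"

instance
  by standard (auto simp: scaleR_fun_def fun_eq_iff scaleR_add_right scaleR_add_left)

end

subsection \<open>Cone orders and the Hilbert projective metric\<close>

definition cone_le :: "'v::real_vector set \<Rightarrow> 'v \<Rightarrow> 'v \<Rightarrow> bool"
  where "cone_le C u v \<longleftrightarrow> v - u \<in> C"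

definition cone_comparable :: "'v::real_vector set \<Rightarrow> 'v \<Rightarrow> 'v \<Rightarrow> bool"
  where "cone_comparable C u v \<longleftrightarrow>
    (\<exists>\<alpha>>0. \<exists>\<beta>>0. cone_le C (\<alpha> *\<^sub>R u) v \<and> cone_le C v (\<beta> *\<^sub>R u))"

definition cone_M :: "'v::real_vector set \<Rightarrow> 'v \<Rightarrow> 'v \<Rightarrow> real"
  where "cone_M C v u = Inf {l. l > 0 \<and> cone_le C v (l *\<^sub>R u)}"

definition cone_m :: "'v::real_vector set \<Rightarrow> 'v \<Rightarrow> 'v \<Rightarrow> real"
  where "cone_m C v u = Sup {l. l > 0 \<and> cone_le C (l *\<^sub>R u) v}"

text \<open>Only meaningful for nonzero elements of a pointed convex cone \<open>C\<close>; then, for comparable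
  \<open>u\<close> and \<open>v\<close>, the sets defining \<^const>\<open>cone_M\<close> and \<^const>\<open>cone_m\<close> are nonempty and bounded and
  both numbers are positive.\<close>

definition hilbert_dist :: "'v::real_vector set \<Rightarrow> 'v \<Rightarrow> 'v \<Rightarrow> ereal"
  where "hilbert_dist C u v =
    (if cone_comparable C u v then ereal (ln (cone_M C v u / cone_m C v u)) else \<infinity>)"

definition ray :: "'v::real_vector \<Rightarrow> 'v set"
  where "ray u = {t *\<^sub>R u | t. t > 0}"

text \<open>The metric on classes modulo positive scalars: the common value of \<^const>\<open>hilbert_dist\<close> on
  representatives; see \<open>hilbert_metric_ray\<close> below for independence of the representatives.\<close>

definition hilbert_metric :: "'v::real_vector set \<Rightarrow> 'v set \<Rightarrow> 'v set \<Rightarrow> ereal"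
  where "hilbert_metric C A B = the_elem {hilbert_dist C u v | u v. u \<in> A \<and> v \<in> B}"

subsection \<open>Equivalent norms\<close>

definition equiv_norms :: "('a::banach \<Rightarrow> real) set"
  where "equiv_norms = {p.
    (\<forall>x. 0 \<le> p x) \<and> (\<forall>x. p x = 0 \<longleftrightarrow> x = 0) \<and>
    (\<forall>c x. p (c *\<^sub>R x) = \<bar>c\<bar> * p x) \<and> (\<forall>x y. p (x + y) \<le> p x + p y) \<and>
    (\<exists>c>0. \<exists>C>0. \<forall>x. c * norm x \<le> p x \<and> p x \<le> C * norm x)}"

definition norm_cone :: "('a::banach \<Rightarrow> real) set"
  where "norm_cone = equiv_norms \<union> {0}"

definition same_intrinsic_part :: "('a::banach \<Rightarrow> real) \<Rightarrow> ('a \<Rightarrow> real) \<Rightarrow> bool"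
  where "same_intrinsic_part p q \<longleftrightarrow>
    p \<in> equiv_norms \<and> q \<in> equiv_norms \<and> cone_comparable norm_cone p q"

definition Delta :: "('a::banach \<Rightarrow> real) \<Rightarrow> 'a \<times> 'a \<Rightarrow> real"
  where "Delta p = (\<lambda>(x, y). p x + p y - p (x + y))"

definition Phi :: "('a::banach \<Rightarrow> real) \<Rightarrow> ('a \<Rightarrow> real) \<times> ('a \<times> 'a \<Rightarrow> real)"
  where "Phi p = (p, Delta p)"

definition norm_differences :: "('a::banach \<Rightarrow> real) set"
  where "norm_differences = {p - q | p q. p \<in> equiv_norms \<and> q \<in> equiv_norms}"

definition U_cone :: "('a::banach \<Rightarrow> real) set"
  where "U_cone = {f \<in> norm_differences. \<exists>r\<in>equiv_norms. \<forall>x. r x \<le> f x} \<union> {0}"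

definition nonneg_functions :: "('b \<Rightarrow> real) set"
  where "nonneg_functions = {f. \<forall>z. 0 \<le> f z}"

definition H_cone :: "(('a::banach \<Rightarrow> real) \<times> ('a \<times> 'a \<Rightarrow> real)) set"
  where "H_cone = U_cone \<times> nonneg_functions"

subsection \<open>The Hilbert metric does not depend on representatives\<close>

lemma Inf_scale:
  fixes S :: "real set"
  assumes "c > 0" "S \<noteq> {}" "bdd_below S"
  shows "Inf ((\<lambda>x. c * x) ` S) = c * Inf S"
  using continuous_at_Inf_mono[of "\<lambda>x. c * x" S] assms
  by (simp add: mono_def continuous_intros)

lemma Sup_scale:
  fixes S :: "real set"
  assumes "c > 0" "S \<noteq> {}" "bdd_above S"
  shows "Sup ((\<lambda>x. c * x) ` S) = c * Sup S"
  using continuous_at_Sup_mono[of "\<lambda>x. c * x" S] assms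
  by (simp add: mono_def continuous_intros)

lemma cone_le_scale:
  assumes sc: "\<And>c x. c > 0 \<Longrightarrow> x \<in> C \<Longrightarrow> c *\<^sub>R x \<in> C" and "c > 0"
  shows "cone_le C (c *\<^sub>R u) (c *\<^sub>R v) \<longleftrightarrow> cone_le C u v"
  unfolding cone_le_def
proof
  assume "v - u \<in> C"
  from sc[OF \<open>c > 0\<close> this] show "c *\<^sub>R v - c *\<^sub>R u \<in> C" by (simp add: scaleR_diff_right)
next
  assume "c *\<^sub>R v - c *\<^sub>R u \<in> C"
  from sc[OF _ this, of "inverse c"] show "v - u \<in> C"
    using \<open>c > 0\<close> by (simp add: scaleR_diff_right)
qed

lemma hilbert_dist_scale:
  fixes C :: "'v::real_vector set"
  assumes add: "\<And>x y. x \<in> C \<Longrightarrow> y \<in> C \<Longrightarrow> x + y \<in> C"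
    and sc: "\<And>c x. c > 0 \<Longrightarrow> x \<in> C \<Longrightarrow> c *\<^sub>R x \<in> C"
    and pointed: "\<And>x. x \<in> C \<Longrightarrow> - x \<in> C \<Longrightarrow> x = 0"
    and u: "u \<in> C" "u \<noteq> 0" and s: "s > 0" and t: "t > 0"
  shows "hilbert_dist C (s *\<^sub>R u) (t *\<^sub>R v) = hilbert_dist C u v"
proof -
  have upper: "cone_le C (t *\<^sub>R v) (l *\<^sub>R s *\<^sub>R u) \<longleftrightarrow> cone_le C v ((l * s / t) *\<^sub>R u)" for l
    using cone_le_scale[OF sc t, of v "(l * s / t) *\<^sub>R u"] t by simp
  have lower: "cone_le C (l *\<^sub>R s *\<^sub>R u) (t *\<^sub>R v) \<longleftrightarrow> cone_le C ((l * s / t) *\<^sub>R u) v" for l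
    using cone_le_scale[OF sc t, of "(l * s / t) *\<^sub>R u" v] t by simp
  have resc: "(\<exists>l>0. P (l * s / t)) \<longleftrightarrow> (\<exists>l>0. P l)" for P
  proof
    assume "\<exists>l>0. P (l * s / t)"
    then obtain l where "l > 0" "P (l * s / t)" by blast
    then show "\<exists>l>0. P l" using s t by (intro exI[of _ "l * s / t"]) simp
  next
    assume "\<exists>l>0. P l"
    then obtain l where "l > 0" "P l" by blast
    then show "\<exists>l>0. P (l * s / t)" using s t by (intro exI[of _ "l * t / s"]) simp
  qed
  have comp: "cone_comparable C (s *\<^sub>R u) (t *\<^sub>R v) \<longleftrightarrow> cone_comparable C u v"
    using resc[of "\<lambda>l. cone_le C (l *\<^sub>R u) v"] resc[of "\<lambda>l. cone_le C v (l *\<^sub>R u)"]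
    unfolding cone_comparable_def upper lower by blast
  have img: "{l. l > 0 \<and> P (l * s / t)} = (\<lambda>x. (t / s) * x) ` {l. l > 0 \<and> P l}" for P
  proof (intro equalityI subsetI)
    fix l assume "l \<in> {l. l > 0 \<and> P (l * s / t)}"
    then show "l \<in> (\<lambda>x. (t / s) * x) ` {l. l > 0 \<and> P l}"
      using s t by (intro image_eqI[of _ _ "l * s / t"]) auto
  qed (use s t in auto)
  show ?thesis
  proof (cases "cone_comparable C u v")
    case True
    then obtain a b where ab: "a > 0" "b > 0" "cone_le C (a *\<^sub>R u) v" "cone_le C v (b *\<^sub>R u)"
      unfolding cone_comparable_def by blast
    have "l \<le> b" if "cone_le C (l *\<^sub>R u) v" for l
    proof (rule ccontr)
      assume "\<not> l \<le> b"
      have "(v - l *\<^sub>R u) + (b *\<^sub>R u - v) \<in> C"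
        using add ab(4) that unfolding cone_le_def by blast
      then have "- ((l - b) *\<^sub>R u) \<in> C" by (simp add: algebra_simps)
      moreover have "(l - b) *\<^sub>R u \<in> C" using sc[of "l - b" u] u \<open>\<not> l \<le> b\<close> by simp
      ultimately show False using pointed u \<open>\<not> l \<le> b\<close> by fastforce
    qed
    then have bdd: "bdd_above {l. l > 0 \<and> cone_le C (l *\<^sub>R u) v}" by (intro bdd_aboveI) blast
    have "cone_m C (t *\<^sub>R v) (s *\<^sub>R u) = (t / s) * cone_m C v u"
      unfolding cone_m_def lower img[of "\<lambda>l. cone_le C (l *\<^sub>R u) v"] using ab s t bdd by (subst Sup_scale) auto
    moreover have "cone_M C (t *\<^sub>R v) (s *\<^sub>R u) = (t / s) * cone_M C v u"
      unfolding cone_M_def upper img[of "\<lambda>l. cone_le C v (l *\<^sub>R u)"] using ab s t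
      by (subst Inf_scale) (auto intro!: bdd_belowI[of _ 0])
    ultimately show ?thesis using True comp s t by (simp add: hilbert_dist_def)
  qed (simp add: hilbert_dist_def comp)
qed

lemma hilbert_metric_ray:
  fixes C :: "'v::real_vector set"
  assumes "\<And>x y. x \<in> C \<Longrightarrow> y \<in> C \<Longrightarrow> x + y \<in> C"
    and "\<And>c x. c > 0 \<Longrightarrow> x \<in> C \<Longrightarrow> c *\<^sub>R x \<in> C"
    and "\<And>x. x \<in> C \<Longrightarrow> - x \<in> C \<Longrightarrow> x = 0"
    and "u \<in> C" "u \<noteq> 0"
  shows "hilbert_metric C (ray u) (ray v) = hilbert_dist C u v"
proof -
  have "{hilbert_dist C x y | x y. x \<in> ray u \<and> y \<in> ray v}
      = {hilbert_dist C (s *\<^sub>R u) (t *\<^sub>R v) | s t. s > 0 \<and> t > 0}"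
    unfolding ray_def by blast
  also have "\<dots> = {hilbert_dist C u v | s t. (s::real) > 0 \<and> (t::real) > 0}"
    using hilbert_dist_scale[OF assms] by (intro Collect_cong) metis
  also have "\<dots> = {hilbert_dist C u v}"
    using zero_less_one by blast
  finally show ?thesis by (simp add: hilbert_metric_def)
qed

end

theory Submission
  imports Defs
begin

text \<open>Since \<open>\<Phi>\<close> is additive and positively homogeneous, everything reduces to the following: for
  norms \<open>p\<close> and \<open>q\<close>, the difference \<open>p - q\<close> is absolutely homogeneous and bounded above by a
  multiple of the given norm, so it is an equivalent norm as soon as it dominates an equivalent
  norm (the \<open>U\<close>-component of the order) and satisfies the triangle inequality (the
  \<open>\<Delta>\<close>-component). Hence both orders agree on norms and their positive multiples, and so do the
  Hilbert metrics.\<close>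

lemma scaleR_fun_apply: "(c *\<^sub>R f) x = c *\<^sub>R f x"
  by (simp add: scaleR_fun_def)

lemma equiv_normsD:
  assumes "p \<in> equiv_norms"
  shows "0 \<le> p x" "p x = 0 \<longleftrightarrow> x = 0" "p (c *\<^sub>R x) = \<bar>c\<bar> * p x" "p (x + y) \<le> p x + p y"
  using assms by (auto simp: equiv_norms_def)

lemma equiv_norms_bounds:
  assumes "p \<in> equiv_norms"
  obtains c C where "c > 0" "C > 0" "\<And>x. c * norm x \<le> p x" "\<And>x. p x \<le> C * norm x"
  using assms unfolding equiv_norms_def by blast

text \<open>The lower bound forces nonnegativity and \<open>x = 0\<close> whenever
  \<open>p x = 0\<close>; the upper bound gives \<open>p 0 = 0\<close>. So homogeneity,
  subadditivity and the two bounds suffice as an introduction rule.\<close>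

lemma equiv_normsI:
  assumes "\<And>c x. p (c *\<^sub>R x) = \<bar>c\<bar> * p x" "\<And>x y. p (x + y) \<le> p x + p y"
    and "c > 0" "C > 0" "\<And>x. c * norm x \<le> p x" "\<And>x. p x \<le> C * norm x"
  shows "p \<in> equiv_norms"
proof -
  have nonneg: "0 \<le> p x" for x
    using order_trans[OF mult_nonneg_nonneg[OF less_imp_le[OF \<open>c > 0\<close>] norm_ge_zero] assms(5)] .
  have "p x = 0 \<longleftrightarrow> x = 0" for x
  proof
    assume "p x = 0"
    with assms(5)[of x] have "c * norm x \<le> 0" by simp
    with \<open>c > 0\<close> show "x = 0" by (simp add: mult_le_0_iff)
  next
    assume "x = 0"
    with assms(6)[of x] nonneg[of x] show "p x = 0" by simp
  qed
  with nonneg assms show ?thesis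
    unfolding equiv_norms_def by (intro CollectI conjI allI exI[of _ c] exI[of _ C]) auto
qed

lemma equiv_norms_add:
  assumes "p \<in> equiv_norms" "q \<in> equiv_norms"
  shows "p + q \<in> equiv_norms"
proof -
  obtain c C where p: "c > 0" "C > 0" "\<And>x. c * norm x \<le> p x" "\<And>x. p x \<le> C * norm x"
    using equiv_norms_bounds[OF assms(1)] by blast
  obtain d D where q: "d > 0" "D > 0" "\<And>x. d * norm x \<le> q x" "\<And>x. q x \<le> D * norm x"
    using equiv_norms_bounds[OF assms(2)] by blast
  show ?thesis
  proof (rule equiv_normsI)
    show "(p + q) (k *\<^sub>R x) = \<bar>k\<bar> * (p + q) x" for k x
      using assms by (simp add: equiv_normsD distrib_left)
    show "(p + q) (x + y) \<le> (p + q) x + (p + q) y" for x y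
      using equiv_normsD(4)[OF assms(1), of x y] equiv_normsD(4)[OF assms(2), of x y] by simp
    show "c + d > 0" "C + D > 0" using p q by auto
    show "(c + d) * norm x \<le> (p + q) x" "(p + q) x \<le> (C + D) * norm x" for x
      using add_mono[OF p(3) q(3)] add_mono[OF p(4) q(4)] by (simp_all add: distrib_right)
  qed
qed

lemma equiv_norms_scaleR:
  assumes "p \<in> equiv_norms" "k > 0"
  shows "k *\<^sub>R p \<in> equiv_norms"
proof -
  obtain c C where p: "c > 0" "C > 0" "\<And>x. c * norm x \<le> p x" "\<And>x. p x \<le> C * norm x"
    using equiv_norms_bounds[OF assms(1)] by blast
  show ?thesis
  proof (rule equiv_normsI)
    show "(k *\<^sub>R p) (l *\<^sub>R x) = \<bar>l\<bar> * (k *\<^sub>R p) x" for l x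
      using assms by (simp add: equiv_normsD scaleR_fun_apply)
    show "(k *\<^sub>R p) (x + y) \<le> (k *\<^sub>R p) x + (k *\<^sub>R p) y" for x y
      using mult_left_mono[OF equiv_normsD(4)[OF assms(1), of x y], of k] assms(2)
      by (simp add: scaleR_fun_apply distrib_left)
    show "k * c > 0" "k * C > 0" using p assms(2) by auto
    show "(k * c) * norm x \<le> (k *\<^sub>R p) x" "(k *\<^sub>R p) x \<le> (k * C) * norm x" for x
      using mult_left_mono[OF p(3)[of x], of k] mult_left_mono[OF p(4)[of x], of k] assms(2)
      by (simp_all add: scaleR_fun_apply mult.assoc)
  qed
qed

lemma norm_cone_nonneg: "f \<in> norm_cone \<Longrightarrow> 0 \<le> f x"
  by (auto simp: norm_cone_def equiv_normsD)

lemma norm_cone_add: "f \<in> norm_cone \<Longrightarrow> g \<in> norm_cone \<Longrightarrow> f + g \<in> norm_cone"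
  by (auto simp: norm_cone_def equiv_norms_add)

lemma norm_cone_scaleR: "c > 0 \<Longrightarrow> f \<in> norm_cone \<Longrightarrow> c *\<^sub>R f \<in> norm_cone"
  by (auto simp: norm_cone_def equiv_norms_scaleR)

text \<open>Both cones are pointed for this one reason: their members are pointwise nonnegative
  functions, or pairs of such.\<close>

lemma nonneg_pointed:
  fixes f :: "'b \<Rightarrow> real"
  assumes "\<And>x. 0 \<le> f x" "\<And>x. 0 \<le> (- f) x"
  shows "f = 0"
proof
  show "f x = 0 x" for x using assms[of x] by simp
qed

lemma norm_cone_pointed: "f \<in> norm_cone \<Longrightarrow> - f \<in> norm_cone \<Longrightarrow> f = 0"
  by (intro nonneg_pointed norm_cone_nonneg)

lemma norm_differences_add:
  assumes "f \<in> norm_differences" "g \<in> norm_differences"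
  shows "f + g \<in> norm_differences"
proof -
  obtain p q p' q' where *: "p \<in> equiv_norms" "q \<in> equiv_norms" "p' \<in> equiv_norms" "q' \<in> equiv_norms"
    and "f = p - q" "g = p' - q'"
    using assms unfolding norm_differences_def by blast
  then have "f + g = (p + p') - (q + q')" by (simp add: fun_eq_iff)
  with * show ?thesis unfolding norm_differences_def by (blast intro: equiv_norms_add)
qed

lemma norm_differences_scaleR:
  assumes "f \<in> norm_differences" "c > 0"
  shows "c *\<^sub>R f \<in> norm_differences"
proof -
  obtain p q where *: "p \<in> equiv_norms" "q \<in> equiv_norms" and "f = p - q"
    using assms unfolding norm_differences_def by blast
  then have "c *\<^sub>R f = c *\<^sub>R p - c *\<^sub>R q" by (simp add: scaleR_diff_right)
  with * \<open>c > 0\<close> show ?thesis unfolding norm_differences_def by (blast intro: equiv_norms_scaleR)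
qed

lemma U_cone_cases:
  assumes "f \<in> U_cone"
  obtains "f = 0"
  | r where "f \<in> norm_differences" "r \<in> equiv_norms" "\<And>x. r x \<le> f x"
  using assms unfolding U_cone_def by blast

lemma zero_in_U_cone: "0 \<in> U_cone"
  by (simp add: U_cone_def)

lemma U_coneI:
  "f \<in> norm_differences \<Longrightarrow> r \<in> equiv_norms \<Longrightarrow> (\<And>x. r x \<le> f x) \<Longrightarrow> f \<in> U_cone"
  unfolding U_cone_def by blast

lemma U_cone_nonneg:
  assumes "f \<in> U_cone"
  shows "0 \<le> f x"
  using assms
proof (cases rule: U_cone_cases)
  case (2 r)
  show ?thesis using equiv_normsD(1)[OF 2(2)] 2(3) by (rule order_trans)
qed simp

lemma U_cone_add:
  assumes "f \<in> U_cone" "g \<in> U_cone"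
  shows "f + g \<in> U_cone"
  using assms(1)
proof (cases rule: U_cone_cases)
  case (2 r)
  show ?thesis
  \<comment> \<open>The norm \<open>r\<close> below \<open>f\<close> also lies below
    \<open>f + g\<close>, because \<open>g\<close> is pointwise nonnegative.\<close>
  proof (rule U_coneI[OF _ 2(2)])
    show "f + g \<in> norm_differences"
      using assms(2) 2(1) by (auto elim!: U_cone_cases intro: norm_differences_add)
    show "r x \<le> (f + g) x" for x
      using 2(3)[of x] U_cone_nonneg[OF assms(2), of x] by simp
  qed
qed (use assms in simp)

lemma U_cone_scaleR:
  assumes "f \<in> U_cone" "c > 0"
  shows "c *\<^sub>R f \<in> U_cone"
  using assms(1)
proof (cases rule: U_cone_cases)
  case 1
  with assms(1) show ?thesis by simp
next
  case (2 r)
  show ?thesis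
  proof (rule U_coneI)
    show "c *\<^sub>R f \<in> norm_differences" "c *\<^sub>R r \<in> equiv_norms"
      using 2 \<open>c > 0\<close> by (simp_all add: norm_differences_scaleR equiv_norms_scaleR)
    show "(c *\<^sub>R r) x \<le> (c *\<^sub>R f) x" for x
      using 2(3) \<open>c > 0\<close> by (simp add: scaleR_fun_apply)
  qed
qed

text \<open>Closure under sums and positive multiples, together with pointedness, is what
  \<open>hilbert_metric_ray\<close> asks of a cone.\<close>

lemma H_cone_add: "u \<in> H_cone \<Longrightarrow> v \<in> H_cone \<Longrightarrow> u + v \<in> H_cone"
  by (auto simp: H_cone_def nonneg_functions_def U_cone_add)

lemma H_cone_scaleR: "c > 0 \<Longrightarrow> u \<in> H_cone \<Longrightarrow> c *\<^sub>R u \<in> H_cone"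
  by (auto simp: H_cone_def nonneg_functions_def U_cone_scaleR scaleR_fun_apply)

lemma H_cone_pointed:
  assumes "u \<in> H_cone" "- u \<in> H_cone"
  shows "u = 0"
proof (rule prod_eqI)
  show "fst u = fst 0"
    using assms U_cone_nonneg unfolding H_cone_def fst_zero
    \<comment> \<open>Keeping \<open>(- fst u) x\<close> folded lets \<open>U_cone_nonneg\<close>
      apply to the function \<open>- fst u\<close>.\<close>
    by (intro nonneg_pointed) (auto simp: mem_Times_iff simp del: uminus_apply)
  show "snd u = snd 0"
    using assms unfolding H_cone_def snd_zero nonneg_functions_def
    by (intro nonneg_pointed) (auto simp: mem_Times_iff)
qed

lemma Phi_scaleR: "Phi (c *\<^sub>R p) = c *\<^sub>R Phi p"
  by (auto simp: Phi_def Delta_def scaleR_fun_apply fun_eq_iff algebra_simps)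

lemma Phi_diff: "Phi (p - q) = Phi p - Phi q"
  by (auto simp: Phi_def Delta_def fun_eq_iff)

text \<open>Nonnegativity of \<open>Delta f\<close> is precisely the triangle inequality for
  \<open>f\<close>.\<close>

lemma Phi_in_H_cone_iff:
  "Phi f \<in> H_cone \<longleftrightarrow> f \<in> U_cone \<and> (\<forall>x y. f (x + y) \<le> f x + f y)"
  by (simp add: Phi_def H_cone_def nonneg_functions_def Delta_def)

lemma equiv_norms_in_U_cone:
  assumes "p \<in> equiv_norms"
  shows "p \<in> U_cone"
proof (rule U_coneI[OF _ assms])
  \<comment> \<open>Writing \<open>p\<close> as \<open>2p - p\<close> makes it a difference of
    norms; the norm below it is \<open>p\<close> itself.\<close>
  have "p = (p + p) - p" by simp
  with assms show "p \<in> norm_differences"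
    unfolding norm_differences_def by (blast intro: equiv_norms_add)
qed simp

text \<open>Homogeneity passes to the difference \<open>p - q\<close>, the upper bound of
  \<open>p\<close> survives since \<open>q\<close> is nonnegative, and \<open>r\<close> supplies the
  lower bound.\<close>

lemma norm_difference_in_equiv_norms:
  assumes "f \<in> norm_differences" "r \<in> equiv_norms" "\<And>x. r x \<le> f x"
    and "\<And>x y. f (x + y) \<le> f x + f y"
  shows "f \<in> equiv_norms"
proof -
  obtain p q where p: "p \<in> equiv_norms" and q: "q \<in> equiv_norms" and f: "f = p - q"
    using assms(1) unfolding norm_differences_def by blast
  obtain c where c: "c > 0" "\<And>x. c * norm x \<le> r x"
    using equiv_norms_bounds[OF assms(2)] by metis
  obtain C where C: "C > 0" "\<And>x. p x \<le> C * norm x"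
    using equiv_norms_bounds[OF p] by metis
  show ?thesis
  proof (rule equiv_normsI[OF _ assms(4) c(1) C(1)])
    show "f (k *\<^sub>R x) = \<bar>k\<bar> * f x" for k x
      using p q by (simp add: f equiv_normsD right_diff_distrib)
    show "c * norm x \<le> f x" for x
      using c(2) assms(3) by (rule order_trans)
    show "f x \<le> C * norm x" for x
      using C(2)[of x] equiv_normsD(1)[OF q, of x] by (simp add: f)
  qed
qed

text \<open>The key equivalence. It is stated for an arbitrary function \<open>f\<close> because it
  will be applied to differences \<open>p - q\<close>, which are not known beforehand to be
  norms.\<close>

lemma Phi_in_H_cone_iff_norm_cone: "Phi f \<in> H_cone \<longleftrightarrow> f \<in> norm_cone"
proof
  assume "Phi f \<in> H_cone"
  then have "f \<in> U_cone" and sub: "\<And>x y. f (x + y) \<le> f x + f y"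
    by (auto simp: Phi_in_H_cone_iff)
  from this(1) show "f \<in> norm_cone"
    by (cases rule: U_cone_cases)
      (auto simp: norm_cone_def intro: norm_difference_in_equiv_norms sub)
next
  assume "f \<in> norm_cone"
  then show "Phi f \<in> H_cone"
    unfolding Phi_in_H_cone_iff norm_cone_def
    by (auto intro: equiv_norms_in_U_cone equiv_normsD(4) simp: zero_in_U_cone)
qed

text \<open>By linearity of \<open>Phi\<close>, the difference of the images is the image of
  \<open>p - q\<close>, so order is decided by membership of \<open>p - q\<close>.\<close>

lemma cone_le_Phi_iff: "cone_le H_cone (Phi q) (Phi p) \<longleftrightarrow> cone_le norm_cone q p"
  unfolding cone_le_def Phi_diff[symmetric] Phi_in_H_cone_iff_norm_cone ..

text \<open>Comparability, \<open>cone_M\<close> and \<open>cone_m\<close> involve only the order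
  between one element and positive multiples of another. Pulling the scalars inside
  \<open>Phi\<close> makes these conditions identical for both cones.\<close>

lemma hilbert_dist_Phi: "hilbert_dist H_cone (Phi p) (Phi q) = hilbert_dist norm_cone p q"
  unfolding hilbert_dist_def cone_comparable_def cone_M_def cone_m_def
    Phi_scaleR[symmetric] cone_le_Phi_iff ..

theorem theorem6p4:
  assumes "(UNIV :: 'a::banach set) \<noteq> {0}"
  shows "(\<forall>p \<in> (equiv_norms :: ('a \<Rightarrow> real) set). \<forall>q \<in> equiv_norms.
            cone_le H_cone (Phi q) (Phi p) \<longleftrightarrow> cone_le norm_cone q p) \<and>
         (\<forall>p \<in> (equiv_norms :: ('a \<Rightarrow> real) set). \<forall>q \<in> equiv_norms.
            same_intrinsic_part p q \<longrightarrow>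
            hilbert_metric H_cone (ray (Phi p)) (ray (Phi q)) =
            hilbert_metric norm_cone (ray p) (ray q))"
proof -
  obtain z :: 'a where z: "z \<noteq> 0" using assms by blast
  have "hilbert_metric H_cone (ray (Phi p)) (ray (Phi q)) = hilbert_metric norm_cone (ray p) (ray q)"
    if p: "p \<in> equiv_norms" for p q :: "'a \<Rightarrow> real"
  proof -
    \<comment> \<open>Here \<open>X\<close> being nontrivial enters: \<open>p\<close> is positive at
      \<open>z\<close>, so \<open>p\<close> and \<open>Phi p\<close> are nonzero, as
      \<open>hilbert_metric_ray\<close> requires.\<close>
    have "p \<noteq> 0" using equiv_normsD(2)[OF p, of z] z by auto
    moreover have "p \<in> norm_cone" using p by (simp add: norm_cone_def)
    moreover have "Phi p \<noteq> 0" using \<open>p \<noteq> 0\<close> by (simp add: Phi_def zero_prod_def)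
    moreover have "Phi p \<in> H_cone" using \<open>p \<in> norm_cone\<close> by (simp add: Phi_in_H_cone_iff_norm_cone)
    ultimately show ?thesis
      by (simp add: hilbert_dist_Phi
          hilbert_metric_ray[OF H_cone_add H_cone_scaleR H_cone_pointed]
          hilbert_metric_ray[OF norm_cone_add norm_cone_scaleR norm_cone_pointed])
  qed
  then show ?thesis by (simp add: cone_le_Phi_iff)
qed

end
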